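(* For $m\ge 0$ let $A(m)=\left|\Pi_m^{eq}\wr C_2(\{1^a1^a,1^b1^b\})\right|$, where $a,b$ are the two colors of $C_2$ (so $A(0)=1$, counting the empty partition, and $A(1)=2$). Then for all $n\ge 2$, $$A(n)=2\bigl(A(n-1)+(n-1)A(n-2)\bigr).$$
   Context: $\Pi_n\wr C_2$ is the set of colored set partitions of $[n]$ with colors $a,b$ (a set partition of $[n]$ plus a color for each element). A colored partition eq-contains $1^\gamma1^\gamma$ if some block contains two elements both colored $\gamma$. $\Pi_n^{eq}\wr C_2(\{1^a1^a,1^b1^b\})$ is the set of colored partitions in which no block contains two elements of the same color. *)

theory Defs
  imports "HOL-Library.Disjoint_Sets" "HOL-Library.FuncSet"
begin

datatype color = Col_a | Col_b

(* A pair of a set partition P of [n] and a coloring c of [n]. Colorings are taken in the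
   extensional function space, so that each coloring of [n] is counted exactly once. *)
definition colored_partitions :: "nat \<Rightarrow> (nat set set \<times> (nat \<Rightarrow> color)) set" where
  "colored_partitions n =
     {(P, c). partition_on {1..n} P \<and> c \<in> {1..n} \<rightarrow>\<^sub>E (UNIV :: color set)}"

(* eq-containment of the one-block pattern 1^g 1^g *)
definition eq_contains_pair :: "nat set set \<times> (nat \<Rightarrow> color) \<Rightarrow> color \<Rightarrow> bool" where
  "eq_contains_pair \<pi> g \<longleftrightarrow>
     (\<exists>B\<in>fst \<pi>. \<exists>i\<in>B. \<exists>j\<in>B. i \<noteq> j \<and> snd \<pi> i = g \<and> snd \<pi> j = g)"

(* The colored partitions of [n] that eq-avoid all patterns 1^g 1^g with g in G. *)
definition eq_avoiding_pairs ::
    "nat \<Rightarrow> color set \<Rightarrow> (nat set set \<times> (nat \<Rightarrow> color)) set" where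
  "eq_avoiding_pairs n G =
     {\<pi> \<in> colored_partitions n. \<forall>g\<in>G. \<not> eq_contains_pair \<pi> g}"

lemma finite_colored_partitions: "finite (colored_partitions n)"
proof (rule finite_subset)
  show "colored_partitions n \<subseteq> Pow (Pow {1..n}) \<times> ({1..n} \<rightarrow>\<^sub>E {Col_a, Col_b})"
    unfolding colored_partitions_def partition_on_def
    by (auto simp: PiE_iff extensional_def intro: color.exhaust)
  show "finite (Pow (Pow {1..n}) \<times> ({1..n} \<rightarrow>\<^sub>E {Col_a, Col_b}))"
    by (intro finite_cartesian_product finite_PiE) auto
qed

lemma finite_eq_avoiding_pairs: "finite (eq_avoiding_pairs n G)"
  using finite_colored_partitions by (simp add: eq_avoiding_pairs_def)

end

theory Submission
  imports Defs
begin

text \<open>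
  A block in which no color repeats has one or two elements. Fix an element \<open>x\<close>:
  deleting its block \<open>B\<close> leaves an arbitrary avoiding colored partition of the complement,
  and \<open>B\<close> itself admits two colorings, whether it is \<open>{x}\<close> or \<open>{x, y}\<close> for one of the
  other elements \<open>y\<close>. Working over arbitrary finite ground sets, the resulting recurrence
  determines the count by induction on the cardinality, so complements need not be
  relabelled.
\<close>

definition injective_colorings :: "'a set \<Rightarrow> ('a \<Rightarrow> color) set" where
  "injective_colorings B = {d \<in> B \<rightarrow>\<^sub>E UNIV. inj_on d B}"

definition avoiding_partitions :: "'a set \<Rightarrow> ('a set set \<times> ('a \<Rightarrow> color)) set" where
  "avoiding_partitions S =
     {(P, c). partition_on S P \<and> c \<in> S \<rightarrow>\<^sub>E UNIV \<and> (\<forall>B\<in>P. inj_on c B)}"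

lemma UNIV_color: "(UNIV :: color set) = {Col_a, Col_b}"
  using color.exhaust by auto

lemma eq_avoiding_pairs_eq:
  "eq_avoiding_pairs n {Col_a, Col_b} = avoiding_partitions {1..n}"
proof -
  have "(\<forall>g\<in>{Col_a, Col_b}. \<not> eq_contains_pair (P, c) g) \<longleftrightarrow> (\<forall>B\<in>P. inj_on c B)" for P c
    \<comment> \<open>Folding the two colors back into \<open>UNIV\<close> lets \<gamma> range over
      every color, so it can be taken to be the common color of two elements.\<close>
    unfolding UNIV_color[symmetric] eq_contains_pair_def inj_on_def fst_conv snd_conv by blast
  then show ?thesis
    by (auto simp: eq_avoiding_pairs_def avoiding_partitions_def colored_partitions_def)
qed

lemma finite_avoiding_partitions:
  assumes "finite S"
  shows "finite (avoiding_partitions S)"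
proof (rule finite_subset)
  show "avoiding_partitions S \<subseteq> Pow (Pow S) \<times> (S \<rightarrow>\<^sub>E UNIV)"
    by (auto simp: avoiding_partitions_def partition_on_def)
  show "finite (Pow (Pow S) \<times> (S \<rightarrow>\<^sub>E (UNIV :: color set)))"
    using assms by (intro finite_cartesian_product finite_PiE) (auto simp: UNIV_color)
qed

text \<open>With injectivity required on the whole domain, the general counting formula becomes a
  falling factorial of 2: it is 2 for one element and 2 * 1 for two.\<close>

lemma card_injective_colorings_singleton: "card (injective_colorings {x}) = 2"
  unfolding injective_colorings_def
  by (subst card_inj_on_subset_funcset) (simp_all add: UNIV_color)

lemma card_injective_colorings_pair:
  assumes "x \<noteq> y"
  shows "card (injective_colorings {x, y}) = 2"
  unfolding injective_colorings_def using assms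
  by (subst card_inj_on_subset_funcset) (simp_all add: UNIV_color numeral_2_eq_2)

text \<open>Avoidance is tested block by block, so the coloring of \<open>B\<close> and the rest of
  the structure are chosen independently. No bound on the size of \<open>B\<close> is required: with
  more than two elements both sides vanish.\<close>

lemma card_avoiding_partitions_with_block:
  assumes "B \<subseteq> S" "B \<noteq> {}"
  shows "card {\<pi> \<in> avoiding_partitions S. B \<in> fst \<pi>} =
    card (avoiding_partitions (S - B)) * card (injective_colorings B)"
proof -
  \<comment> \<open>\<open>f\<close> cuts the coloring along \<open>B\<close> and its complement,
    and \<open>g\<close> glues the pieces. The restrictions reset outside values to
    \<open>undefined\<close>, so both pieces are again extensional.\<close>
  define f :: "'a set set \<times> ('a \<Rightarrow> color) \<Rightarrow> _"
    where "f = (\<lambda>(P, c). ((P - {B}, restrict c (S - B)), restrict c B))"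
  define g :: "_ \<Rightarrow> 'a set set \<times> ('a \<Rightarrow> color)"
    where "g = (\<lambda>((P, c), d). (insert B P, \<lambda>i. if i \<in> B then d i else c i))"
  have block: "C \<subseteq> S - B" if "partition_on (S - B) P" "C \<in> P" for P C
    using that by (auto simp: partition_on_def)
  \<comment> \<open>This gives \<open>insert B P - {B} = P\<close>, so \<open>f\<close> recovers
    \<open>P\<close> after \<open>g\<close>.\<close>
  have notin: "B \<notin> P" if "partition_on (S - B) P" for P
    using block[OF that] assms by blast
  have ins: "partition_on S (insert B P) \<longleftrightarrow> partition_on (S - B) P" if "disjnt B (\<Union>P)" for P
    using partition_on_insert[OF that] assms by blast
  have "bij_betw f {\<pi> \<in> avoiding_partitions S. B \<in> fst \<pi>}
      (avoiding_partitions (S - B) \<times> injective_colorings B)"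
  proof (rule bij_betw_byWitness[where f' = g])
    show "\<forall>\<pi>\<in>{\<pi> \<in> avoiding_partitions S. B \<in> fst \<pi>}. g (f \<pi>) = \<pi>"
      using assms
      by (auto simp: f_def g_def avoiding_partitions_def PiE_iff extensional_def fun_eq_iff)
    show "\<forall>\<rho>\<in>avoiding_partitions (S - B) \<times> injective_colorings B. f (g \<rho>) = \<rho>"
      using assms notin
      by (auto simp: f_def g_def avoiding_partitions_def injective_colorings_def PiE_iff
          extensional_def fun_eq_iff)
    show "f ` {\<pi> \<in> avoiding_partitions S. B \<in> fst \<pi>}
        \<subseteq> avoiding_partitions (S - B) \<times> injective_colorings B"
    proof (rule image_subsetI)
      fix \<pi> assume "\<pi> \<in> {\<pi> \<in> avoiding_partitions S. B \<in> fst \<pi>}"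
      then obtain P c where \<pi>: "\<pi> = (P, c)" and P: "partition_on S P" "B \<in> P"
        and inj: "\<And>C. C \<in> P \<Longrightarrow> inj_on c C"
        by (auto simp: avoiding_partitions_def)
      have "disjnt B (\<Union>(P - {B}))"
        using P by (auto simp: partition_on_def disjoint_def disjnt_def)
      then have P': "partition_on (S - B) (P - {B})"
        using ins[of "P - {B}"] P by (simp add: insert_absorb)
      have "inj_on (restrict c (S - B)) C" if "C \<in> P - {B}" for C
        using inj[of C] that block[OF P' that] by (simp add: inj_on_def subset_iff)
      then show "f \<pi> \<in> avoiding_partitions (S - B) \<times> injective_colorings B"
        using P' inj[OF P(2)]
        by (auto simp: \<pi> f_def avoiding_partitions_def injective_colorings_def)
    qed
    show "g ` (avoiding_partitions (S - B) \<times> injective_colorings B)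
        \<subseteq> {\<pi> \<in> avoiding_partitions S. B \<in> fst \<pi>}"
    proof (rule image_subsetI)
      fix \<rho> assume "\<rho> \<in> avoiding_partitions (S - B) \<times> injective_colorings B"
      then obtain P c d where \<rho>: "\<rho> = ((P, c), d)"
        and Pc: "(P, c) \<in> avoiding_partitions (S - B)" and d: "d \<in> injective_colorings B"
        by auto
      let ?e = "\<lambda>i. if i \<in> B then d i else c i"
      from Pc have P: "partition_on (S - B) P" and inj: "\<And>C. C \<in> P \<Longrightarrow> inj_on c C"
        by (auto simp: avoiding_partitions_def)
      have "disjnt B (\<Union>P)"
        using P by (auto simp: partition_on_def disjnt_def)
      then have "partition_on S (insert B P)"
        using ins P by blast
      moreover have "inj_on ?e C" if "C \<in> P" for C
        using inj[OF that] block[OF P that] by (auto simp: inj_on_def)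
      moreover have "inj_on ?e B"
        using d by (auto simp: injective_colorings_def inj_on_def)
      moreover have "?e \<in> S \<rightarrow>\<^sub>E UNIV"
        using Pc d assms
        by (auto simp: avoiding_partitions_def injective_colorings_def PiE_iff extensional_def)
      ultimately show "g \<rho> \<in> {\<pi> \<in> avoiding_partitions S. B \<in> fst \<pi>}"
        by (auto simp: \<rho> g_def avoiding_partitions_def)
    qed
  qed
  then show ?thesis
    by (simp add: bij_betw_same_card card_cartesian_product)
qed

lemma avoiding_partitions_block_cases:
  assumes "(P, c) \<in> avoiding_partitions S" "x \<in> S"
  obtains "{x} \<in> P" | y where "y \<in> S - {x}" "{x, y} \<in> P"
proof -
  from assms obtain B where B: "B \<in> P" "x \<in> B" "B \<subseteq> S" and inj: "inj_on c B"
    by (auto simp: avoiding_partitions_def partition_on_def)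
  show thesis
  proof (cases "B = {x}")
    case False
    then obtain y where y: "y \<in> B" "y \<noteq> x"
      using B by blast
    \<comment> \<open>By injectivity \<open>x\<close> and \<open>y\<close> already use both colors,
      so \<open>z\<close> shares its color with one of them and must equal it.\<close>
    have "z = x \<or> z = y" if "z \<in> B" for z
      using inj that y B by (metis (full_types) color.exhaust inj_onD)
    then have "B = {x, y}"
      using y B by blast
    with y B that(2) show thesis
      by blast
  qed (use B that in blast)
qed

lemma card_avoiding_partitions_insert:
  assumes "finite S" "x \<notin> S"
  shows "card (avoiding_partitions (insert x S)) =
    2 * (card (avoiding_partitions S) + (\<Sum>y\<in>S. card (avoiding_partitions (S - {y}))))"
proof -
  define F where "F B = {\<pi> \<in> avoiding_partitions (insert x S). B \<in> fst \<pi>}" for B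
  have fin: "finite (F B)" for B
    using finite_avoiding_partitions[of "insert x S"] assms by (simp add: F_def)
  \<comment> \<open>Distinct blocks of one partition cannot share \<open>x\<close>.\<close>
  have disj: "F B \<inter> F C = {}" if "x \<in> B" "x \<in> C" "B \<noteq> C" for B C
  proof -
    have "\<not> (B \<in> P \<and> C \<in> P)" if "partition_on (insert x S) P" for P
      using that \<open>x \<in> B\<close> \<open>x \<in> C\<close> \<open>B \<noteq> C\<close> unfolding partition_on_def disjoint_def by blast
    then show ?thesis
      by (auto simp: F_def avoiding_partitions_def)
  qed
  have "avoiding_partitions (insert x S) = F {x} \<union> (\<Union>y\<in>S. F {x, y})"
  proof (intro equalityI subsetI)
    fix \<pi> assume \<pi>: "\<pi> \<in> avoiding_partitions (insert x S)"
    obtain P c where "\<pi> = (P, c)"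
      by fastforce
    with \<pi> show "\<pi> \<in> F {x} \<union> (\<Union>y\<in>S. F {x, y})"
      by (auto simp: F_def elim: avoiding_partitions_block_cases[where x = x])
  qed (auto simp: F_def)
  moreover have "F {x} \<inter> (\<Union>y\<in>S. F {x, y}) = {}"
  proof -
    have "F {x} \<inter> F {x, y} = {}" if "y \<in> S" for y
      using that assms by (intro disj) auto
    then show ?thesis
      by blast
  qed
  moreover have "card (\<Union>y\<in>S. F {x, y}) = (\<Sum>y\<in>S. card (F {x, y}))"
    \<comment> \<open>Distinct indices \<open>y\<close> give distinct sets \<open>{x, y}\<close>, so
      \<open>disj\<close> applies to them.\<close>
    using assms fin by (intro card_UN_disjoint ballI impI disj) (auto simp: doubleton_eq_iff)
  ultimately have "card (avoiding_partitions (insert x S)) =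
      card (F {x}) + (\<Sum>y\<in>S. card (F {x, y}))"
    using assms fin by (simp add: card_Un_disjoint)
  moreover have "card (F {x}) = 2 * card (avoiding_partitions S)"
    using assms card_avoiding_partitions_with_block[of "{x}" "insert x S"]
    by (simp add: F_def card_injective_colorings_singleton)
  moreover have "card (F {x, y}) = 2 * card (avoiding_partitions (S - {y}))" if "y \<in> S" for y
  proof -
    have "insert x S - {x, y} = S - {y}" "x \<noteq> y"
      using assms that by auto
    then show ?thesis
      using that card_avoiding_partitions_with_block[of "{x, y}" "insert x S"]
      by (simp add: F_def card_injective_colorings_pair)
  qed
  ultimately show ?thesis
    by (simp add: sum_distrib_left)
qed

lemma avoiding_partitions_empty: "avoiding_partitions {} = {({}, \<lambda>_. undefined)}"
  by (auto simp: avoiding_partitions_def partition_on_def)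

text \<open>The sequence 1, 2, 6, 20, 76, ... with exponential generating function exp(2x + x^2).
  The index is shifted by two, so the factor n - 1 appears as \<open>Suc n\<close>.\<close>

fun avoiding_count :: "nat \<Rightarrow> nat" where
  "avoiding_count 0 = 1"
| "avoiding_count (Suc 0) = 2"
| "avoiding_count (Suc (Suc n)) = 2 * (avoiding_count (Suc n) + Suc n * avoiding_count n)"

text \<open>Strong induction is used because the recurrence removes one or two elements; keeping
  \<open>S\<close> arbitrary covers all the sets \<open>T - {y}\<close> at once.\<close>

lemma card_avoiding_partitions:
  assumes "finite S"
  shows "card (avoiding_partitions S) = avoiding_count (card S)"
  using assms
proof (induction "card S" arbitrary: S rule: less_induct)
  case less
  show ?case
  proof (cases "S = {}")
    case False
    then obtain x T where S: "S = insert x T" "x \<notin> T"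
      by (metis ex_in_conv mk_disjoint_insert)
    with less.prems have T: "finite T"
      by simp
    have "card (avoiding_partitions T) = avoiding_count (card T)"
      using less.hyps[of T] S T by simp
    moreover have "card (avoiding_partitions (T - {y})) = avoiding_count (card T - 1)"
      if "y \<in> T" for y
      using less.hyps[of "T - {y}"] S T that by (simp add: card_Diff_singleton)
    ultimately have "card (avoiding_partitions S) =
        2 * (avoiding_count (card T) + card T * avoiding_count (card T - 1))"
      using S T by (simp add: card_avoiding_partitions_insert)
    then show ?thesis
      \<comment> \<open>If \<open>card T = 0\<close>, the truncated \<open>card T - 1\<close> is
        harmless: the factor \<open>card T\<close> kills its term and leaves 2 * 1, the value at
        1.\<close>
      using S T by (cases "card T") auto
  qed (simp add: avoiding_partitions_empty)
qed

theorem theorem3p5: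
  fixes A :: "nat \<Rightarrow> nat"
  assumes A_def: "\<And>m. A m = card (eq_avoiding_pairs m {Col_a, Col_b})"
  shows "A 0 = 1 \<and> A 1 = 2 \<and>
         (\<forall>n\<ge>2. A n = 2 * (A (n - 1) + (n - 1) * A (n - 2)))"
proof -
  have A: "A m = avoiding_count m" for m
    by (simp add: A_def eq_avoiding_pairs_eq card_avoiding_partitions)
  have "A n = 2 * (A (n - 1) + (n - 1) * A (n - 2))" if "n \<ge> 2" for n
  proof -
    obtain k where "n = 2 + k"
      using \<open>n \<ge> 2\<close> le_Suc_ex by blast
    then show ?thesis
      by (simp add: A)
  qed
  then show ?thesis
    by (simp add: A)
qed

end
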